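(* Let $D$ be an $\aleph_1$-complete filter on a cardinal $\kappa$, and $\bar\lambda=\langle\lambda_i:i<\kappa\rangle$ a sequence of regular cardinals $>2^\kappa$ such that $\lambda=\|\bar\lambda\|_{D+A}$ for every $A\in D^+$. Let $\mu_i<\mathfrak{dp}^{1+}_{\lambda_i}$ for $i<\kappa$ and $\mu<\mathrm{Depth}^+(\prod_{i<\kappa}\mu_i,<_D)$. Then $\mu<\mathfrak{dp}^{1+}_\lambda$.
   Context: $D^+=\{A\subseteq\kappa:\kappa\setminus A\notin D\}$; $D+A$ is the filter generated by $D\cup\{A\}$. For an $\aleph_1$-complete filter $E$ and $f\in{}^\kappa\mathrm{Ord}$, $\|f\|_E=\bigcup\{\|g\|_E+1:g<_E f\}$ with $g<_E f$ meaning $\{i:g(i)<f(i)\}\in E$. For regular $\chi>\aleph_0$, $\mathfrak{dp}^{1+}_\chi$ is the least $\theta$ such that there is no sequence $\langle C_\alpha:\alpha<\theta\rangle$ of clubs of $\chi$ with $|C_\alpha\setminus C_\beta|<\chi$ for $\alpha<\beta$ and $C_{\alpha+1}\subseteq\mathrm{acc}(C_\alpha)$ (the set of accumulation points). $\mathrm{Depth}^+(\prod\mu_i,<_D)$ is the least $\chi$ with no sequence of length $\chi$ in $\prod\mu_i$ strictly increasing under $<_D$.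
   Formalization: In the definition of 𝔡𝔭^{1+}_χ the smallness condition is taken as |C_β \ C_α| < χ for α < β; the version |C_α \ C_β| < χ contradicts C_{α+1} ⊆ acc(C_α), since C_α \ acc(C_α) has size χ, so no sequence of length 2 would exist. *)

theory Defs
  imports Complex_Main "HOL-Library.Countable_Set"
begin

unbundle cardinal_syntax

text \<open>
  Ordinals are the elements of an arbitrary type \<open>'o\<close> of class \<open>wellorder\<close>, that is, of an
  initial segment of Ord; theorems are polymorphic in \<open>'o\<close>, so this segment is as long as
  one likes. As with von Neumann ordinals, \<open>\<alpha>\<close> is identified with \<open>{..<\<alpha>}\<close>. A notion whose
  value may lie outside the segment (the norm and the two depth invariants) is defined as the
  set of those elements of \<open>'o\<close> that lie below its value; \<open>UNIV\<close> then says that the value is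
  not below any element of \<open>'o\<close> or does not exist. In particular such a set is equal to
  \<open>{..<\<lambda>}\<close> only if the value is truly \<open>\<lambda>\<close>, since \<open>\<lambda>\<close> is not a member of \<open>{..<\<lambda>}\<close>.

  The cardinal \<open>\<kappa>\<close> is represented by a type \<open>'k\<close> as index set, and a filter on it by
  \<open>'k filter\<close>.
\<close>


subsection \<open>Ordinals and cardinals\<close>

definition ord_rel :: "'o::wellorder \<Rightarrow> 'o rel" where
  "ord_rel \<alpha> = {(x, y). x \<le> y \<and> y < \<alpha>}"

definition regular_cardinal :: "'o::wellorder \<Rightarrow> bool" where
  "regular_cardinal \<alpha> \<longleftrightarrow>
     Card_order (ord_rel \<alpha>) \<and> cinfinite (ord_rel \<alpha>) \<and> regularCard (ord_rel \<alpha>)"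

text \<open>Meaningful only if \<open>\<alpha>\<close> is not the largest element of \<open>'o\<close>.\<close>

definition ord_succ :: "'o::wellorder \<Rightarrow> 'o" where
  "ord_succ \<alpha> = (LEAST \<beta>. \<alpha> < \<beta>)"

text \<open>The successor in the von Neumann representation, see the lemma below.\<close>

definition seg_succ :: "'o::wellorder set \<Rightarrow> 'o set" where
  "seg_succ S = {\<beta>. {..<\<beta>} \<subseteq> S}"

lemma seg_succ_lessThan: "seg_succ {..<\<alpha>} = insert \<alpha> {..<\<alpha>}"
  by (auto simp: seg_succ_def subset_iff) (meson le_less_linear less_irrefl neqE)

lemma Field_ord_rel: "Field (ord_rel \<alpha>) = {..<\<alpha>}"
  by (auto simp: ord_rel_def Field_def)


subsection \<open>Filters\<close>

definition aleph1_complete :: "'k filter \<Rightarrow> bool" where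
  "aleph1_complete D \<longleftrightarrow>
     (\<forall>\<A>. countable \<A> \<and> (\<forall>A\<in>\<A>. \<forall>\<^sub>F i in D. i \<in> A) \<longrightarrow> (\<forall>\<^sub>F i in D. i \<in> \<Inter>\<A>))"

definition positive_sets :: "'k filter \<Rightarrow> 'k set set" where
  "positive_sets D = {A. \<not> (\<forall>\<^sub>F i in D. i \<in> UNIV - A)}"

definition filter_plus :: "'k filter \<Rightarrow> 'k set \<Rightarrow> 'k filter" where
  "filter_plus D A = inf D (principal A)"

definition less_mod :: "'k filter \<Rightarrow> ('k \<Rightarrow> 'o::wellorder) \<Rightarrow> ('k \<Rightarrow> 'o) \<Rightarrow> bool" where
  "less_mod E g f \<longleftrightarrow> (\<forall>\<^sub>F i in E. g i < f i)"


subsection \<open>The Galvin--Hajnal norm\<close>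

text \<open>
  The norm is the solution of the recursion stated in \<open>gh_norm_unfold\<close>. For a proper
  \<open>\<aleph>\<^sub>1\<close>-complete filter, \<open>less_mod E\<close> is well-founded (\<open>wfp_less_mod\<close>), so that the
  recursion has exactly one solution.
\<close>

definition gh_norm :: "'k filter \<Rightarrow> ('k \<Rightarrow> 'o::wellorder) \<Rightarrow> 'o set" where
  "gh_norm E = lfp (\<lambda>N f. \<Union>g\<in>{g. less_mod E g f}. seg_succ (N g))"

lemma gh_norm_unfold: "gh_norm E f = (\<Union>g\<in>{g. less_mod E g f}. seg_succ (gh_norm E g))"
proof -
  have "mono (\<lambda>N f. \<Union>g\<in>{g. less_mod E g f}. seg_succ (N g))"
    unfolding mono_def le_fun_def seg_succ_def by blast
  from lfp_unfold [OF this] show ?thesis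
    unfolding gh_norm_def by metis
qed

lemma wfp_less_mod:
  fixes E :: "'k filter"
  assumes "E \<noteq> bot" and "aleph1_complete E"
  shows "wfp (less_mod E :: ('k \<Rightarrow> 'o::wellorder) \<Rightarrow> _)"
proof -
  have False if chain: "\<And>n. less_mod E (f (Suc n)) (f n)" for f :: "nat \<Rightarrow> 'k \<Rightarrow> 'o"
  proof -
    let ?\<A> = "range (\<lambda>n. {i. f (Suc n) i < f n i})"
    have "countable ?\<A>" and "\<forall>A\<in>?\<A>. \<forall>\<^sub>F i in E. i \<in> A"
      using chain by (auto simp: less_mod_def)
    then have "\<forall>\<^sub>F i in E. i \<in> \<Inter>?\<A>"
      using assms(2) unfolding aleph1_complete_def by blast
    then obtain i where "\<And>n. f (Suc n) i < f n i"
      using assms(1) eventually_happens' by fastforce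
    then have "\<exists>h. \<forall>n. (h (Suc n), h n) \<in> {(x, y). x < (y::'o)}"
      by (intro exI[of _ "\<lambda>n. f n i"]) simp
    then show False
      using wf unfolding wf_iff_no_infinite_down_chain by blast
  qed
  then have "wf {(g, f). less_mod E g (f :: 'k \<Rightarrow> 'o)}"
    unfolding wf_iff_no_infinite_down_chain by blast
  then show ?thesis
    by (simp add: wfp_def)
qed


subsection \<open>Depth of club sequences\<close>

definition acc :: "'o::wellorder \<Rightarrow> 'o set \<Rightarrow> 'o set" where
  "acc \<chi> C = {\<delta>. \<delta> < \<chi> \<and> C \<inter> {..<\<delta>} \<noteq> {} \<and> (\<forall>\<gamma><\<delta>. \<exists>\<xi>\<in>C. \<gamma> < \<xi> \<and> \<xi> < \<delta>)}"

definition club :: "'o::wellorder \<Rightarrow> 'o set \<Rightarrow> bool" where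
  "club \<chi> C \<longleftrightarrow> C \<subseteq> {..<\<chi>} \<and> (\<forall>\<gamma><\<chi>. \<exists>\<xi>\<in>C. \<gamma> < \<xi>) \<and> acc \<chi> C \<subseteq> C"

text \<open>
  The sequence decreases modulo sets of size less than \<open>\<chi>\<close>: the small difference is the later
  club minus the earlier one. Smallness of \<open>C \<alpha> - C \<beta>\<close> for \<open>\<alpha> < \<beta>\<close> would be incompatible
  with \<open>C (\<alpha> + 1) \<subseteq> acc (C \<alpha>)\<close>, as \<open>C \<alpha> - acc (C \<alpha>)\<close> has size \<open>\<chi>\<close> for regular \<open>\<chi>\<close>.
\<close>

definition dp_sequence :: "'o::wellorder \<Rightarrow> 'o \<Rightarrow> ('o \<Rightarrow> 'o set) \<Rightarrow> bool" where
  "dp_sequence \<chi> \<theta> C \<longleftrightarrow>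
     (\<forall>\<alpha><\<theta>. club \<chi> (C \<alpha>)) \<and>
     (\<forall>\<alpha> \<beta>. \<alpha> < \<beta> \<and> \<beta> < \<theta> \<longrightarrow> |C \<beta> - C \<alpha>| <o ord_rel \<chi>) \<and>
     (\<forall>\<alpha>. \<alpha> < \<theta> \<and> ord_succ \<alpha> < \<theta> \<longrightarrow> C (ord_succ \<alpha>) \<subseteq> acc \<chi> (C \<alpha>))"

text \<open>
  The intersection of a nonempty set of von Neumann ordinals is its least element; the empty
  intersection is \<open>UNIV\<close>.
\<close>

definition dp1_plus :: "'o::wellorder \<Rightarrow> 'o set" where
  "dp1_plus \<chi> = (\<Inter>\<theta>\<in>{\<theta>. \<nexists>C. dp_sequence \<chi> \<theta> C}. {..<\<theta>})"


subsection \<open>Depth of products modulo a filter\<close>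

definition depth_sequence ::
    "'k filter \<Rightarrow> ('k \<Rightarrow> 'o::wellorder) \<Rightarrow> 'o \<Rightarrow> ('o \<Rightarrow> 'k \<Rightarrow> 'o) \<Rightarrow> bool" where
  "depth_sequence D \<mu> \<theta> f \<longleftrightarrow>
     (\<forall>\<alpha><\<theta>. \<forall>i. f \<alpha> i < \<mu> i) \<and>
     (\<forall>\<alpha> \<beta>. \<alpha> < \<beta> \<and> \<beta> < \<theta> \<longrightarrow> less_mod D (f \<alpha>) (f \<beta>))"

definition Depth_plus :: "'k filter \<Rightarrow> ('k \<Rightarrow> 'o::wellorder) \<Rightarrow> 'o set" where
  "Depth_plus D \<mu> = (\<Inter>\<theta>\<in>{\<theta>. \<nexists>f. depth_sequence D \<mu> \<theta> f}. {..<\<theta>})"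

end

theory Submission
  imports Defs
begin

text \<open>
  A sequence of clubs \<open>C i\<close> of \<open>lam i\<close> is sent to the closure in \<open>lambda\<close> of the set of norms
  \<open>\<parallel>h\<parallel>\<^sub>D\<close> with \<open>h i \<in> C i\<close> for \<open>D\<close>-almost all \<open>i\<close>. If \<open>h i\<close> is an accumulation point of
  \<open>C i\<close> almost everywhere, then the functions below \<open>h\<close> with values in \<open>C i\<close> are cofinal
  below \<open>h\<close>, so \<open>\<parallel>h\<parallel>\<^sub>D\<close> is an accumulation point of the norms coming from \<open>C\<close>. Moreover
  a function \<open>h\<close> whose norm is large is \<open>D\<close>-almost everywhere above any given \<open>b < lam\<close>:
  otherwise \<open>\<parallel>h\<parallel>\<^sub>D \<le> \<parallel>b\<parallel>\<^bsub>D+A\<^esub>\<close> for a positive set \<open>A\<close>, and these \<open>2^\<kappa>\<close> values are bounded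
  below \<open>lambda\<close>. Hence inclusions that hold modulo bounded sets in the \<open>lam i\<close> carry over to
  \<open>lambda\<close>, and an increasing sequence of functions modulo \<open>D\<close> yields a sequence of
  clubs with each contained, modulo a bounded set, in the accumulation points of every earlier
  one.
\<close>

subsection \<open>Ordinals\<close>

lemma less_ord_succ: "(\<alpha>::'o::wellorder) < \<beta> \<Longrightarrow> \<alpha> < ord_succ \<alpha>"
  unfolding ord_succ_def by (rule LeastI)

lemma ord_succ_le: "(\<alpha>::'o::wellorder) < \<beta> \<Longrightarrow> ord_succ \<alpha> \<le> \<beta>"
  unfolding ord_succ_def by (rule Least_le)

lemma less_ord_succD: "\<beta> < ord_succ \<alpha> \<Longrightarrow> \<beta> \<le> (\<alpha>::'o::wellorder)"
  using ord_succ_le [of \<alpha> \<beta>] by (meson leD leI)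

lemma Well_order_ord_rel: "Well_order (ord_rel (\<alpha>::'o::wellorder))"
proof -
  have "ord_rel \<alpha> - Id \<subseteq> {(x, y). x < y}"
    by (auto simp: ord_rel_def)
  then have "wf (ord_rel \<alpha> - Id)"
    using wf wf_subset by blast
  moreover have "Linear_order (ord_rel \<alpha>)"
    unfolding order_on_defs Field_ord_rel
    by (auto simp: ord_rel_def refl_on_def trans_def antisym_def total_on_def)
  ultimately show ?thesis
    unfolding well_order_on_def by blast
qed

text \<open>\<open>ord_rel \<xi>\<close> is a proper initial segment of
  \<open>ord_rel \<chi>\<close>, and a cardinal is the least well-order on its set. This turns
  bounded differences of clubs into small ones.\<close>

lemma card_of_lessThan_ordLess:
  assumes "(\<xi>::'o::wellorder) < \<chi>"
  shows "|{..<\<xi>}| <o ord_rel \<chi>"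
proof -
  have us: "underS (ord_rel \<chi>) \<xi> = {..<\<xi>}"
    using assms by (auto simp: underS_def ord_rel_def)
  have "Restr (ord_rel \<chi>) (underS (ord_rel \<chi>) \<xi>) <o ord_rel \<chi>"
    using assms by (intro underS_Restr_ordLess Well_order_ord_rel) (auto simp: Field_ord_rel)
  moreover have "Restr (ord_rel \<chi>) (underS (ord_rel \<chi>) \<xi>) = ord_rel \<xi>"
    unfolding us using assms by (auto simp: ord_rel_def)
  moreover have "|{..<\<xi>}| \<le>o ord_rel \<xi>"
    by (intro card_of_least) (metis Field_ord_rel Well_order_ord_rel)
  ultimately show ?thesis
    using ordLeq_ordLess_trans by metis
qed

lemma regular_cardinal_bounded:
  assumes reg: "regular_cardinal (\<chi>::'o::wellorder)"
    and sub: "X \<subseteq> {..<\<chi>}" and small: "|X| <o ord_rel \<chi>"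
  shows "\<exists>\<gamma><\<chi>. \<forall>\<xi>\<in>X. \<xi> \<le> \<gamma>"
proof (rule ccontr)
  assume "\<not> ?thesis"
  then have "\<forall>\<gamma><\<chi>. \<exists>\<xi>\<in>X. \<gamma> < \<xi>"
    by (meson leI)
  moreover have "a \<noteq> \<xi> \<and> (a, \<xi>) \<in> ord_rel \<chi>" if "\<xi> \<in> X" "a < \<xi>" for a \<xi>
    using that sub by (auto simp: ord_rel_def)
  ultimately have "\<forall>a\<in>Field (ord_rel \<chi>). \<exists>b\<in>X. a \<noteq> b \<and> (a, b) \<in> ord_rel \<chi>"
    unfolding Field_ord_rel by (meson lessThan_iff)
  then have "|X| =o ord_rel \<chi>"
    using reg sub unfolding regular_cardinal_def regularCard_def cofinal_def Field_ord_rel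
    by blast
  then show False
    using small not_ordLess_ordIso by blast
qed

text \<open>A sequence restricted to a shorter length is still a witness, so the lengths without one
  form a final segment.\<close>

lemma mem_dp1_plus_iff: "\<theta> \<in> dp1_plus \<chi> \<longleftrightarrow> (\<exists>C. dp_sequence \<chi> \<theta> C)"
proof
  show "\<theta> \<in> dp1_plus \<chi> \<Longrightarrow> \<exists>C. dp_sequence \<chi> \<theta> C"
    unfolding dp1_plus_def by auto
  assume "\<exists>C. dp_sequence \<chi> \<theta> C"
  then obtain C where "dp_sequence \<chi> \<theta> C" ..
  then have "dp_sequence \<chi> \<theta>' C" if "\<theta>' \<le> \<theta>" for \<theta>'
    using that unfolding dp_sequence_def by (meson order.strict_trans2)
  then show "\<theta> \<in> dp1_plus \<chi>"
    unfolding dp1_plus_def by (auto intro: leI)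
qed

lemma mem_Depth_plusD: "\<theta> \<in> Depth_plus D \<mu> \<Longrightarrow> \<exists>f. depth_sequence D \<mu> \<theta> f"
  unfolding Depth_plus_def by auto


subsection \<open>Accumulation points and trimming of clubs\<close>

lemma accD: "\<delta> \<in> acc \<chi> C \<Longrightarrow> \<gamma> < \<delta> \<Longrightarrow> \<exists>\<xi>\<in>C. \<gamma> < \<xi> \<and> \<xi> < \<delta>"
  by (simp add: acc_def)

lemma acc_nonempty: "\<delta> \<in> acc \<chi> C \<Longrightarrow> \<exists>\<xi>\<in>C. \<xi> < \<delta>"
  by (auto simp: acc_def)

lemma acc_less: "\<delta> \<in> acc \<chi> C \<Longrightarrow> \<delta> < \<chi>"
  by (simp add: acc_def)

lemma accI:
  assumes "\<delta> < \<chi>" "\<xi>0 < \<delta>" "\<And>\<gamma>. \<gamma> < \<delta> \<Longrightarrow> \<exists>\<xi>\<in>C. \<gamma> < \<xi> \<and> \<xi> < \<delta>"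
  shows "\<delta> \<in> acc \<chi> C"
  unfolding acc_def using assms by blast

text \<open>Below an accumulation point of \<open>S\<close> that exceeds \<gamma> lies a point of
  \<open>S\<close> that exceeds \<gamma>. Hence adding accumulation points once already closes
  \<open>S\<close>.\<close>

lemma acc_Un_acc: "acc \<chi> (S \<union> acc \<chi> S) = acc \<chi> S"
proof
  show "acc \<chi> S \<subseteq> acc \<chi> (S \<union> acc \<chi> S)"
    unfolding acc_def by blast
  show "acc \<chi> (S \<union> acc \<chi> S) \<subseteq> acc \<chi> S"
  proof
    fix \<delta> assume d: "\<delta> \<in> acc \<chi> (S \<union> acc \<chi> S)"
    obtain \<xi>0 where "\<xi>0 < \<delta>" using acc_nonempty [OF d] by blast
    with acc_less [OF d] show "\<delta> \<in> acc \<chi> S"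
    proof (rule accI)
      fix \<gamma> assume "\<gamma> < \<delta>"
      then obtain \<xi> where "\<xi> \<in> S \<union> acc \<chi> S" "\<gamma> < \<xi>" "\<xi> < \<delta>"
        using accD [OF d] by blast
      then show "\<exists>\<xi>\<in>S. \<gamma> < \<xi> \<and> \<xi> < \<delta>"
        using accD by (metis UnE order.strict_trans)
    qed
  qed
qed

lemma club_closure:
  assumes "S \<subseteq> {..<\<chi>}" "\<And>\<gamma>. \<gamma> < \<chi> \<Longrightarrow> \<exists>\<xi>\<in>S. \<gamma> < \<xi>"
  shows "club \<chi> (S \<union> acc \<chi> S)"
  unfolding club_def acc_Un_acc using assms acc_less by blast

text \<open>A limit of \<open>S1\<close> above \<gamma> is a limit of points of \<open>S1\<close>
  above \<gamma>, all of them in \<open>acc \<chi> S0\<close>, so the same bound serves for the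
  closures.\<close>

lemma closure_subset_acc:
  assumes "\<And>\<xi>. \<xi> \<in> S1 \<Longrightarrow> \<gamma> < \<xi> \<Longrightarrow> \<xi> \<in> acc \<chi> S0"
    and "\<delta> \<in> S1 \<union> acc \<chi> S1" "\<gamma> < \<delta>"
  shows "\<delta> \<in> acc \<chi> (S0 \<union> acc \<chi> S0)"
proof (cases "\<delta> \<in> S1")
  case True
  then show ?thesis using assms by (simp add: acc_Un_acc)
next
  case False
  then have d: "\<delta> \<in> acc \<chi> S1" using assms by blast
  show ?thesis
  proof (rule accI)
    show "\<delta> < \<chi>" using d by (rule acc_less)
    show "\<gamma> < \<delta>" by fact
    fix \<gamma>' assume "\<gamma>' < \<delta>"
    then obtain \<xi> where "\<xi> \<in> S1" "max \<gamma> \<gamma>' < \<xi>" "\<xi> < \<delta>"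
      using accD [OF d, of "max \<gamma> \<gamma>'"] assms(3) by auto
    then show "\<exists>\<xi>\<in>S0 \<union> acc \<chi> S0. \<gamma>' < \<xi> \<and> \<xi> < \<delta>"
      using assms(1) by (intro bexI [of _ \<xi>]) auto
  qed
qed

text \<open>Finitely many bounds have a maximum below \<delta>; infinitely many could be cofinal in
  \<delta>.\<close>

lemma acc_trim:
  assumes "finite B" "\<delta> \<in> acc \<chi> C" "\<forall>b\<in>B. b < \<delta>"
  shows "\<delta> \<in> acc \<chi> {\<xi>\<in>C. \<forall>b\<in>B. b < \<xi>}"
proof -
  obtain \<xi>0 where x0: "\<xi>0 < \<delta>" using acc_nonempty [OF assms(2)] by blast
  show ?thesis
  proof (rule accI)
    show "\<delta> < \<chi>" using assms(2) by (rule acc_less)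
    show "\<xi>0 < \<delta>" by fact
    fix \<gamma> assume "\<gamma> < \<delta>"
    then have "Max (insert \<gamma> B) < \<delta>" using assms by simp
    from accD [OF assms(2) this] obtain \<xi> where "\<xi> \<in> C" "Max (insert \<gamma> B) < \<xi>" "\<xi> < \<delta>" by blast
    then show "\<exists>\<xi>\<in>{\<xi>\<in>C. \<forall>b\<in>B. b < \<xi>}. \<gamma> < \<xi> \<and> \<xi> < \<delta>"
      using assms(1) by auto
  qed
qed

lemma club_trim:
  assumes "finite B" "club \<chi> C" "\<forall>b\<in>B. b < \<chi>"
  shows "club \<chi> {\<xi>\<in>C. \<forall>b\<in>B. b < \<xi>}"
  unfolding club_def
proof (intro conjI allI impI)
  show "{\<xi>\<in>C. \<forall>b\<in>B. b < \<xi>} \<subseteq> {..<\<chi>}"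
    using assms(2) unfolding club_def by blast
  fix \<gamma> assume "\<gamma> < \<chi>"
  then have "Max (insert \<gamma> B) < \<chi>" using assms by simp
  then obtain \<xi> where "\<xi> \<in> C" "Max (insert \<gamma> B) < \<xi>"
    using assms(2) unfolding club_def by blast
  then show "\<exists>\<xi>\<in>{\<xi>\<in>C. \<forall>b\<in>B. b < \<xi>}. \<gamma> < \<xi>"
    using assms(1) by auto
next
  show "acc \<chi> {\<xi>\<in>C. \<forall>b\<in>B. b < \<xi>} \<subseteq> {\<xi>\<in>C. \<forall>b\<in>B. b < \<xi>}"
  proof
    fix \<delta> assume d: "\<delta> \<in> acc \<chi> {\<xi>\<in>C. \<forall>b\<in>B. b < \<xi>}"
    then have "\<delta> \<in> acc \<chi> C" unfolding acc_def by blast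
    moreover have "\<forall>b\<in>B. b < \<delta>"
      using acc_nonempty [OF d] by (auto intro: order.strict_trans)
    ultimately show "\<delta> \<in> {\<xi>\<in>C. \<forall>b\<in>B. b < \<xi>}"
      using assms(2) unfolding club_def by blast
  qed
qed

text \<open>The least member \<open>m\<close> has a finite interval up to \<alpha>, and this
  interval contains all members.\<close>

lemma finite_finite_predecessors:
  "finite {\<beta>. \<beta> < (\<alpha>::'o::wellorder) \<and> finite {\<beta>..<\<alpha>}}" (is "finite ?F")
proof (cases "?F = {}")
  case False
  define m where "m = (LEAST \<beta>. \<beta> \<in> ?F)"
  have "m \<in> ?F" using False unfolding m_def by (metis LeastI ex_in_conv)
  moreover have "?F \<subseteq> {m..<\<alpha>}"
    unfolding m_def by (auto intro: Least_le)
  ultimately show ?thesis using finite_subset by blast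
qed (metis finite.emptyI)

text \<open>
  Writing \<open>\<alpha> = \<delta> + n\<close> with \<open>\<delta>\<close> zero or a limit, one removes from \<open>E \<alpha>\<close> an initial segment
  containing the finitely many exceptional bounds of the steps \<open>\<delta> + k\<close> to \<open>\<delta> + k + 1\<close> for
  \<open>k < n\<close>. This makes the inclusions at successors exact.
\<close>

lemma dp_sequence_of_almost:
  fixes \<chi> \<theta> :: "'o::wellorder"
  assumes club: "\<And>\<alpha>. \<alpha> < \<theta> \<Longrightarrow> club \<chi> (E \<alpha>)"
    and acc: "\<And>\<alpha> \<beta>. \<alpha> < \<beta> \<Longrightarrow> \<beta> < \<theta> \<Longrightarrow>
      \<exists>\<gamma><\<chi>. \<forall>\<xi>\<in>E \<beta>. \<gamma> < \<xi> \<longrightarrow> \<xi> \<in> acc \<chi> (E \<alpha>)"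
  shows "\<exists>C. dp_sequence \<chi> \<theta> C"
proof -
  \<comment> \<open>The guard \<alpha> < \<theta> supplies a point above \<alpha>, which makes
    \<open>ord_succ \<alpha>\<close> a true successor.\<close>
  have "\<exists>\<gamma>. ord_succ \<alpha> < \<theta> \<and> \<alpha> < \<theta> \<longrightarrow>
      \<gamma> < \<chi> \<and> (\<forall>\<xi>\<in>E (ord_succ \<alpha>). \<gamma> < \<xi> \<longrightarrow> \<xi> \<in> acc \<chi> (E \<alpha>))" for \<alpha>
    using acc [of \<alpha> "ord_succ \<alpha>"] less_ord_succ [of \<alpha> \<theta>] by blast
  then obtain b where b: "\<And>\<alpha>. ord_succ \<alpha> < \<theta> \<Longrightarrow> \<alpha> < \<theta> \<Longrightarrow> b \<alpha> < \<chi>"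
    "\<And>\<alpha> \<xi>. ord_succ \<alpha> < \<theta> \<Longrightarrow> \<alpha> < \<theta> \<Longrightarrow> \<xi> \<in> E (ord_succ \<alpha>) \<Longrightarrow> b \<alpha> < \<xi> \<Longrightarrow> \<xi> \<in> acc \<chi> (E \<alpha>)"
    by metis
  \<comment> \<open>Finiteness of \<open>{\<beta>..<\<alpha>}\<close> says that \<alpha> is \<beta>
    plus a natural number, so \<open>B \<alpha>\<close> is empty at zero and at limits.\<close>
  define B where "B \<alpha> = b ` {\<beta>. \<beta> < \<alpha> \<and> finite {\<beta>..<\<alpha>}}" for \<alpha>
  have fin: "finite (B \<alpha>)" for \<alpha>
    unfolding B_def by (intro finite_imageI finite_finite_predecessors)
  have Bless: "x < \<chi>" if "\<alpha> < \<theta>" "x \<in> B \<alpha>" for \<alpha> x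
  proof -
    obtain \<beta> where "x = b \<beta>" "\<beta> < \<alpha>" using \<open>x \<in> B \<alpha>\<close> unfolding B_def by blast
    then show ?thesis using b(1) [of \<beta>] that(1) ord_succ_le [of \<beta> \<alpha>] by auto
  qed
  have B_succ: "insert (b \<alpha>) (B \<alpha>) \<subseteq> B (ord_succ \<alpha>)" if "\<alpha> < \<theta>" for \<alpha>
  proof -
    have lt: "\<alpha> < ord_succ \<alpha>" using that by (rule less_ord_succ)
    have "{\<beta>..<ord_succ \<alpha>} \<subseteq> insert \<alpha> {\<beta>..<\<alpha>}" for \<beta>
      using less_ord_succD by fastforce
    then have "finite {\<beta>..<\<alpha>} \<Longrightarrow> finite {\<beta>..<ord_succ \<alpha>}" for \<beta>
      by (meson finite.insertI finite_subset)
    moreover have "finite {\<alpha>..<\<alpha>}" by simp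
    ultimately show ?thesis
      unfolding B_def using lt by (blast intro: order.strict_trans)
  qed
  define C where "C \<alpha> = {\<xi>\<in>E \<alpha>. \<forall>x\<in>B \<alpha>. x < \<xi>}" for \<alpha>
  have clubC: "club \<chi> (C \<alpha>)" if "\<alpha> < \<theta>" for \<alpha>
    unfolding C_def using club_trim [OF fin club [OF that]] Bless [OF that] by blast
  have "|C \<beta> - C \<alpha>| <o ord_rel \<chi>" if ab: "\<alpha> < \<beta>" "\<beta> < \<theta>" for \<alpha> \<beta>
  proof -
    obtain \<gamma> where g: "\<gamma> < \<chi>" "\<forall>\<xi>\<in>E \<beta>. \<gamma> < \<xi> \<longrightarrow> \<xi> \<in> acc \<chi> (E \<alpha>)"
      using acc ab by blast
    have a: "\<alpha> < \<theta>" using ab by simp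
    have "Max (insert \<gamma> (B \<alpha>)) < \<chi>" using fin Bless [OF a] g by simp
    \<comment> \<open>The difference may contain the maximum itself, hence a strictly larger
      \<open>m\<close>, found in the unbounded set \<open>E \<alpha>\<close>.\<close>
    then obtain m where m: "m < \<chi>" "Max (insert \<gamma> (B \<alpha>)) < m"
      using club [OF a] unfolding club_def by blast
    have "C \<beta> - C \<alpha> \<subseteq> {..<m}"
    proof
      fix x assume x: "x \<in> C \<beta> - C \<alpha>"
      show "x \<in> {..<m}"
      proof (rule ccontr)
        assume "x \<notin> {..<m}"
        then have "Max (insert \<gamma> (B \<alpha>)) < x" using m by simp
        then have "\<gamma> < x" "\<forall>y\<in>B \<alpha>. y < x" using fin by simp_all
        moreover have "x \<in> E \<beta>" using x unfolding C_def by blast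
        ultimately have "x \<in> C \<alpha>"
          using g club [OF a] unfolding C_def club_def by blast
        then show False using x by blast
      qed
    qed
    then show ?thesis
      using card_of_lessThan_ordLess [OF m(1)] card_of_mono1 ordLeq_ordLess_trans by blast
  qed
  moreover have "C (ord_succ \<alpha>) \<subseteq> acc \<chi> (C \<alpha>)" if "\<alpha> < \<theta>" "ord_succ \<alpha> < \<theta>" for \<alpha>
  proof
    fix \<xi> assume "\<xi> \<in> C (ord_succ \<alpha>)"
    \<comment> \<open>Being above \<open>b \<alpha>\<close> puts \<xi> into
      \<open>acc \<chi> (E \<alpha>)\<close>; being above \<open>B \<alpha>\<close> keeps it an
      accumulation point after trimming.\<close>
    then have "\<xi> \<in> E (ord_succ \<alpha>)" "\<forall>x\<in>insert (b \<alpha>) (B \<alpha>). x < \<xi>"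
      using B_succ [OF that(1)] unfolding C_def by blast+
    then show "\<xi> \<in> acc \<chi> (C \<alpha>)"
      unfolding C_def using b(2) that fin by (intro acc_trim) auto
  qed
  ultimately show ?thesis
    using clubC unfolding dp_sequence_def by blast
qed


subsection \<open>The Galvin--Hajnal norm\<close>

lemma seg_succ_downward: "x \<in> seg_succ S \<Longrightarrow> y \<le> x \<Longrightarrow> y \<in> seg_succ S"
  unfolding seg_succ_def by fastforce

lemma gh_norm_downward: "x \<in> gh_norm E f \<Longrightarrow> y \<le> x \<Longrightarrow> y \<in> gh_norm E f"
  using seg_succ_downward by (subst (asm) gh_norm_unfold, subst gh_norm_unfold) blast

lemma seg_succ_gh_norm_subset: "less_mod E g f \<Longrightarrow> seg_succ (gh_norm E g) \<subseteq> gh_norm E f"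
  by (subst (2) gh_norm_unfold) blast

lemma gh_norm_mono:
  assumes "\<forall>\<^sub>F i in E. f i \<le> g i"
  shows "gh_norm E f \<subseteq> gh_norm E g"
proof -
  have "less_mod E h g" if "less_mod E h f" for h
    using that assms unfolding less_mod_def by eventually_elim simp
  then show ?thesis
    by (subst (1 2) gh_norm_unfold) blast
qed

text \<open>\<open>E \<le> D\<close> means that \<open>E\<close> has more large sets, so more
  functions lie below \<open>f\<close> modulo \<open>E\<close>, and the recursion operator
  grows.\<close>

lemma gh_norm_antimono_filter:
  fixes f :: "'k \<Rightarrow> 'o::wellorder"
  assumes "E \<le> D"
  shows "gh_norm D f \<subseteq> gh_norm E f"
proof -
  have "less_mod D g f \<Longrightarrow> less_mod E g f" for f g :: "'k \<Rightarrow> 'o"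
    using assms unfolding less_mod_def le_filter_def by blast
  then have "(gh_norm D :: ('k \<Rightarrow> 'o) \<Rightarrow> _) \<le> gh_norm E"
    unfolding gh_norm_def by (intro lfp_mono) (auto simp: le_fun_def)
  then show ?thesis by (simp add: le_fun_def)
qed

text \<open>The norm of \<open>g\<close> is an initial segment that misses \<nu>, so it is not
  \<open>UNIV\<close> but the segment below its least missing point.\<close>

lemma gh_norm_below:
  assumes f: "gh_norm E f = {..<\<nu>}" and gf: "less_mod E g f"
  shows "\<exists>\<rho><\<nu>. gh_norm E g = {..<\<rho>}"
proof -
  define \<rho> where "\<rho> = (LEAST x. x \<notin> gh_norm E g)"
  have sub: "seg_succ (gh_norm E g) \<subseteq> {..<\<nu>}"
    using seg_succ_gh_norm_subset [OF gf] f by simp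
  have "gh_norm E g \<subseteq> seg_succ (gh_norm E g)"
    using gh_norm_downward unfolding seg_succ_def by fastforce
  then have "\<nu> \<notin> gh_norm E g" using sub by blast
  then have nin: "\<rho> \<notin> gh_norm E g" unfolding \<rho>_def by (rule LeastI)
  have "x \<in> gh_norm E g" if "x < \<rho>" for x
    using that not_less_Least unfolding \<rho>_def by blast
  moreover have "x < \<rho>" if "x \<in> gh_norm E g" for x
    using that nin gh_norm_downward leI by blast
  ultimately have eq: "gh_norm E g = {..<\<rho>}" by blast
  then have "\<rho> \<in> seg_succ (gh_norm E g)" by (simp add: seg_succ_def)
  then show ?thesis using eq sub by blast
qed

text \<open>\<gamma> lies in one of the sets whose union is the norm, and that set is
  \<open>{..<\<rho>}\<close> with \<rho> added; hence only \<gamma> \<le> \<rho>.\<close>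

lemma gh_norm_approx:
  assumes f: "gh_norm E f = {..<\<nu>}" and "\<gamma> < \<nu>"
  shows "\<exists>g \<rho>. less_mod E g f \<and> gh_norm E g = {..<\<rho>} \<and> \<gamma> \<le> \<rho> \<and> \<rho> < \<nu>"
proof -
  have "\<gamma> \<in> gh_norm E f" using assms by simp
  then obtain g where g: "less_mod E g f" "\<gamma> \<in> seg_succ (gh_norm E g)"
    by (subst (asm) gh_norm_unfold) blast
  obtain \<rho> where r: "\<rho> < \<nu>" "gh_norm E g = {..<\<rho>}"
    using gh_norm_below [OF f g(1)] by blast
  have "\<gamma> \<in> insert \<rho> {..<\<rho>}"
    using g(2) unfolding r(2) seg_succ_lessThan .
  then have "\<gamma> \<le> \<rho>" by auto
  then show ?thesis using g(1) r by blast
qed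

lemma gh_norm_strict:
  assumes "less_mod E g f" "gh_norm E g = {..<\<rho>}" "gh_norm E f = {..<\<sigma>}"
  shows "\<rho> < \<sigma>"
proof -
  have "insert \<rho> {..<\<rho>} \<subseteq> {..<\<sigma>}"
    using seg_succ_gh_norm_subset [OF assms(1)] unfolding assms seg_succ_lessThan .
  then show ?thesis by blast
qed

text \<open>The bound \<open>2^\<kappa> < lam i\<close> enters only here.\<close>

lemma large_norm_dominates:
  fixes D :: "'k filter" and lam :: "'k \<Rightarrow> 'o::wellorder"
  assumes ne: "D \<noteq> bot"
    and reg: "\<And>i. regular_cardinal (lam i)"
    and card: "\<And>i. |UNIV :: 'k set set| <o ord_rel (lam i)"
    and norm: "\<And>A. A \<in> positive_sets D \<Longrightarrow> gh_norm (filter_plus D A) lam = {..<lambda}"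
    and normD: "gh_norm D lam = {..<lambda}"
    and b: "less_mod D b lam"
  shows "\<exists>\<gamma><lambda. \<forall>h \<sigma>. gh_norm D h = {..<\<sigma>} \<and> \<gamma> < \<sigma> \<longrightarrow> less_mod D b h"
proof -
  have le: "filter_plus D A \<le> D" for A
    by (simp add: filter_plus_def)
  have bA: "less_mod (filter_plus D A) b lam" for A
    using b le unfolding less_mod_def le_filter_def by blast
  \<comment> \<open>Each ordinal \<open>r A\<close> below \<open>lambda\<close> is traded for a
    function \<open>g A\<close> below \<open>lam\<close> of at least that norm. A common bound can
    then be formed coordinatewise, by regularity of each \<open>lam i\<close>.\<close>
  have "\<exists>r g. A \<in> positive_sets D \<longrightarrow> gh_norm (filter_plus D A) b = {..<r} \<and>
      less_mod D g lam \<and> {..<r} \<subseteq> gh_norm D g" for A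
  proof (cases "A \<in> positive_sets D")
    case True
    obtain r where r: "r < lambda" "gh_norm (filter_plus D A) b = {..<r}"
      using gh_norm_below [OF norm [OF True] bA] by blast
    obtain g \<rho> where "less_mod D g lam" "gh_norm D g = {..<\<rho>}" "r \<le> \<rho>"
      using gh_norm_approx [OF normD r(1)] by blast
    then show ?thesis using r by (intro exI [of _ r] exI [of _ g]) auto
  qed simp
  then obtain r g where rg: "\<And>A. A \<in> positive_sets D \<Longrightarrow> gh_norm (filter_plus D A) b = {..<r A}"
    "\<And>A. A \<in> positive_sets D \<Longrightarrow> less_mod D (g A) lam"
    "\<And>A. A \<in> positive_sets D \<Longrightarrow> {..<r A} \<subseteq> gh_norm D (g A)"
    by metis
  \<comment> \<open>Values not below \<open>lam i\<close> are left out; for positive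
    \<open>A\<close> they occur only on a null set of indices.\<close>
  have "\<exists>\<gamma><lam i. \<forall>\<xi>\<in>{g A i |A. g A i < lam i}. \<xi> \<le> \<gamma>" for i
  proof (rule regular_cardinal_bounded [OF reg])
    have "{g A i |A. g A i < lam i} \<subseteq> (\<lambda>A. g A i) ` UNIV" by blast
    then have "|{g A i |A. g A i < lam i}| \<le>o |UNIV :: 'k set set|"
      by (meson card_of_image card_of_mono1 ordLeq_transitive)
    then show "|{g A i |A. g A i < lam i}| <o ord_rel (lam i)"
      using card ordLeq_ordLess_trans by blast
  qed blast
  then obtain gs where gs: "\<And>i. gs i < lam i" "\<And>i A. g A i < lam i \<Longrightarrow> g A i \<le> gs i"
    by (simp add: Bex_def) metis
  have "less_mod D gs lam" using gs(1) by (simp add: less_mod_def)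
  then obtain \<gamma> where \<gamma>: "\<gamma> < lambda" "gh_norm D gs = {..<\<gamma>}"
    using gh_norm_below [OF normD] by blast
  have r_le: "r A \<le> \<gamma>" if A: "A \<in> positive_sets D" for A
  proof -
    have "\<forall>\<^sub>F i in D. g A i \<le> gs i"
      using rg(2) [OF A] unfolding less_mod_def by eventually_elim (rule gs(2))
    from gh_norm_mono [OF this] have "{..<r A} \<subseteq> {..<\<gamma>}"
      using rg(3) [OF A] unfolding \<gamma>(2) by (rule order.trans [rotated])
    then show ?thesis by (meson leI less_irrefl lessThan_iff subsetD)
  qed
  have "less_mod D b h" if h: "gh_norm D h = {..<\<sigma>}" "\<gamma> < \<sigma>" for h \<sigma>
  proof (rule ccontr)
    assume not: "\<not> less_mod D b h"
    define A where "A = {i. h i \<le> b i}"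
    have A: "A \<in> positive_sets D"
      using not unfolding positive_sets_def A_def less_mod_def by (simp add: not_le)
    have "\<forall>\<^sub>F i in filter_plus D A. h i \<le> b i"
      unfolding filter_plus_def eventually_inf_principal A_def by simp
    \<comment> \<open>Passing from \<open>D\<close> to \<open>filter_plus D A\<close> can only
      enlarge the norm of \<open>h\<close>, and modulo the latter filter \<open>h\<close> is at most
      \<open>b\<close>.\<close>
    then have "gh_norm D h \<subseteq> {..<r A}"
      using gh_norm_mono gh_norm_antimono_filter [OF le] rg(1) [OF A] by blast
    then have "\<gamma> < r A" using h by auto
    then show False using r_le [OF A] by simp
  qed
  then show ?thesis using \<gamma>(1) by blast
qed


subsection \<open>Norms of functions into a product of clubs\<close>

text \<open>Membership is asked only almost everywhere, since the functions chosen coordinatewise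
  below are controlled only at almost all indices.\<close>

definition norm_values :: "'k filter \<Rightarrow> ('k \<Rightarrow> 'o::wellorder set) \<Rightarrow> 'o set" where
  "norm_values D C = {\<rho>. \<exists>h. (\<forall>\<^sub>F i in D. h i \<in> C i) \<and> gh_norm D h = {..<\<rho>}}"

lemma norm_values_subset:
  assumes norm: "gh_norm D lam = {..<lambda}" and C: "\<And>i. C i \<subseteq> {..<lam i}"
  shows "norm_values D C \<subseteq> {..<lambda}"
proof
  fix \<rho> assume "\<rho> \<in> norm_values D C"
  then obtain h where h: "\<forall>\<^sub>F i in D. h i \<in> C i" "gh_norm D h = {..<\<rho>}"
    unfolding norm_values_def by blast
  have "less_mod D h lam"
    unfolding less_mod_def by (rule eventually_mono [OF h(1)]) (use C in blast)
  then show "\<rho> \<in> {..<lambda}" using gh_norm_strict h(2) norm by blast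
qed

text \<open>A function below \<open>lam\<close> of norm at least \<gamma> is pushed up strictly into
  the clubs, which makes the norm exceed \<gamma>.\<close>

lemma norm_values_unbounded:
  assumes norm: "gh_norm D lam = {..<lambda}" and C: "\<And>i. club (lam i) (C i)"
    and "\<gamma> < lambda"
  shows "\<exists>\<xi>\<in>norm_values D C. \<gamma> < \<xi>"
proof -
  obtain g \<rho> where g: "less_mod D g lam" "gh_norm D g = {..<\<rho>}" "\<gamma> \<le> \<rho>"
    using gh_norm_approx [OF norm \<open>\<gamma> < lambda\<close>] by blast
  have "\<exists>\<xi>. g i < lam i \<longrightarrow> \<xi> \<in> C i \<and> g i < \<xi>" for i
    using C unfolding club_def by blast
  then obtain h where h: "\<And>i. g i < lam i \<Longrightarrow> h i \<in> C i \<and> g i < h i" by metis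
  have hC: "\<forall>\<^sub>F i in D. h i \<in> C i" and gh: "less_mod D g h"
    using g(1) h unfolding less_mod_def by (auto elim: eventually_mono)
  have "less_mod D h lam"
    unfolding less_mod_def
    by (rule eventually_mono [OF hC]) (use C in \<open>auto simp: club_def\<close>)
  then obtain \<sigma> where s: "gh_norm D h = {..<\<sigma>}"
    using gh_norm_below [OF norm] by blast
  then have "\<gamma> < \<sigma>" using gh_norm_strict [OF gh g(2)] g(3) by simp
  then show ?thesis using s hC unfolding norm_values_def by blast
qed

text \<open>Any \<open>g\<close> below \<open>h\<close> modulo \<open>D\<close> can be interpolated
  by some \<open>g'\<close> with values in the \<open>C i\<close>, and the norms of such
  \<open>g\<close> are cofinal below \<sigma>.\<close>

lemma norm_mem_acc_norm_values:
  assumes norm: "gh_norm D lam = {..<lambda}" and \<sigma>: "\<sigma> < lambda"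
    and h: "\<forall>\<^sub>F i in D. h i \<in> acc (lam i) (C i)" and s: "gh_norm D h = {..<\<sigma>}"
  shows "\<sigma> \<in> acc lambda (norm_values D C)"
proof -
  have above: "\<exists>\<xi>\<in>norm_values D C. \<rho> < \<xi> \<and> \<xi> < \<sigma>"
    if g: "less_mod D g h" "gh_norm D g = {..<\<rho>}" for g \<rho>
  proof -
    have "\<exists>\<xi>. g i < h i \<and> h i \<in> acc (lam i) (C i) \<longrightarrow> \<xi> \<in> C i \<and> g i < \<xi> \<and> \<xi> < h i" for i
      using accD by metis
    then obtain g' where g': "\<And>i. g i < h i \<Longrightarrow> h i \<in> acc (lam i) (C i) \<Longrightarrow>
        g' i \<in> C i \<and> g i < g' i \<and> g' i < h i" by metis
    have ev: "\<forall>\<^sub>F i in D. g' i \<in> C i \<and> g i < g' i \<and> g' i < h i"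
      using g(1) h unfolding less_mod_def by eventually_elim (rule g')
    then have 1: "less_mod D g g'" and 2: "less_mod D g' h" and 3: "\<forall>\<^sub>F i in D. g' i \<in> C i"
      unfolding less_mod_def by (auto elim: eventually_mono)
    obtain \<xi> where x: "\<xi> < \<sigma>" "gh_norm D g' = {..<\<xi>}"
      using gh_norm_below [OF s 2] by blast
    then have "\<rho> < \<xi>" using gh_norm_strict [OF 1 g(2)] by blast
    then show ?thesis using x 3 unfolding norm_values_def by blast
  qed
  \<comment> \<open>An accumulation point must not be the least ordinal; some \<open>g0\<close>
    below \<open>h\<close> shows that \<sigma> is not.\<close>
  have "\<exists>\<xi>. h i \<in> acc (lam i) (C i) \<longrightarrow> \<xi> < h i" for i
    using acc_nonempty by metis
  then obtain g0 where "\<And>i. h i \<in> acc (lam i) (C i) \<Longrightarrow> g0 i < h i" by metis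
  then have "less_mod D g0 h"
    using h unfolding less_mod_def by (auto elim: eventually_mono)
  then obtain \<xi>0 where x0: "\<xi>0 < \<sigma>" using gh_norm_below [OF s] by blast
  show ?thesis
  proof (rule accI [OF \<sigma> x0])
    fix \<gamma> assume "\<gamma> < \<sigma>"
    then obtain g \<rho> where "less_mod D g h" "gh_norm D g = {..<\<rho>}" "\<gamma> \<le> \<rho>"
      using gh_norm_approx [OF s] by blast
    then show "\<exists>\<xi>\<in>norm_values D C. \<gamma> < \<xi> \<and> \<xi> < \<sigma>"
      using above by (meson order.strict_trans1)
  qed
qed

text \<open>The club at the successor of \<alpha> lies inside
  \<open>acc \<chi> (C \<alpha>)\<close>, and \<open>C \<beta>\<close> exceeds it only by a small
  set, which is bounded by regularity.\<close>

lemma dp_sequence_almost_acc: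
  assumes reg: "regular_cardinal \<chi>" and dp: "dp_sequence \<chi> \<theta> C"
    and "\<alpha> < \<beta>" "\<beta> < \<theta>"
  shows "\<exists>b<\<chi>. \<forall>\<xi>\<in>C \<beta>. b < \<xi> \<longrightarrow> \<xi> \<in> acc \<chi> (C \<alpha>)"
proof -
  define s where "s = ord_succ \<alpha>"
  have s: "s \<le> \<beta>" "\<alpha> < \<theta>" "s < \<theta>"
    using ord_succ_le [OF \<open>\<alpha> < \<beta>\<close>] assms unfolding s_def by auto
  have sub: "C s \<subseteq> acc \<chi> (C \<alpha>)" and club: "C \<beta> \<subseteq> {..<\<chi>}"
    using dp s \<open>\<beta> < \<theta>\<close> unfolding dp_sequence_def club_def s_def by blast+
  show ?thesis
  proof (cases "s = \<beta>")
    case True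
    have "\<exists>b. b < \<chi>"
      using reg unfolding regular_cardinal_def cinfinite_def Field_ord_rel
      by (metis finite.emptyI lessThan_iff subsetI subset_empty)
    then show ?thesis using True sub by blast
  next
    case False
    then have "|C \<beta> - C s| <o ord_rel \<chi>"
      using dp s \<open>\<beta> < \<theta>\<close> unfolding dp_sequence_def by auto
    then obtain b where "b < \<chi>" "\<forall>\<xi>\<in>C \<beta> - C s. \<xi> \<le> b"
      using regular_cardinal_bounded [OF reg, of "C \<beta> - C s"] club by blast
    then show ?thesis using sub by (intro exI [of _ b]) (auto simp: not_le [symmetric])
  qed
qed

theorem theorem5p11:
  fixes D :: "'k filter"
    and lam mu :: "'k \<Rightarrow> 'o::wellorder"
    and lambda mu0 :: 'o
  assumes "D \<noteq> bot" and "aleph1_complete D"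
    and "\<And>i. regular_cardinal (lam i)"
    and "\<And>i. |UNIV :: 'k set set| <o ord_rel (lam i)"
    and "\<And>A. A \<in> positive_sets D \<Longrightarrow> {..<lambda} = gh_norm (filter_plus D A) lam"
    and "\<And>i. mu i \<in> dp1_plus (lam i)"
    and "mu0 \<in> Depth_plus D mu"
  shows "mu0 \<in> dp1_plus lambda"
proof -
  \<comment> \<open>Adding \<open>UNIV\<close> leaves \<open>D\<close> unchanged, which yields the
    norm modulo \<open>D\<close> itself.\<close>
  have "UNIV \<in> positive_sets D"
    using assms(1) by (simp add: positive_sets_def trivial_limit_def)
  then have norm: "gh_norm D lam = {..<lambda}"
    using assms(5) [of UNIV] by (simp add: filter_plus_def)
  obtain C where C: "\<And>i. dp_sequence (lam i) (mu i) (C i)"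
    using assms(6) unfolding mem_dp1_plus_iff by metis
  obtain f where "depth_sequence D mu mu0 f"
    using mem_Depth_plusD [OF assms(7)] by blast
  then have f_less: "\<And>\<alpha> i. \<alpha> < mu0 \<Longrightarrow> f \<alpha> i < mu i"
    and f_inc: "\<And>\<alpha> \<beta>. \<alpha> < \<beta> \<Longrightarrow> \<beta> < mu0 \<Longrightarrow> less_mod D (f \<alpha>) (f \<beta>)"
    unfolding depth_sequence_def by blast+
  define S where "S \<alpha> = norm_values D (\<lambda>i. C i (f \<alpha> i))" for \<alpha>
  have clubC: "club (lam i) (C i (f \<alpha> i))" if "\<alpha> < mu0" for \<alpha> i
    using C f_less [OF that] unfolding dp_sequence_def by blast
  have S_sub: "S \<alpha> \<subseteq> {..<lambda}" if "\<alpha> < mu0" for \<alpha>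
    using norm_values_subset [OF norm, of "\<lambda>i. C i (f \<alpha> i)"] clubC [OF that]
    unfolding S_def club_def by blast
  have "\<exists>\<gamma><lambda. \<forall>\<xi>\<in>S \<beta>. \<gamma> < \<xi> \<longrightarrow> \<xi> \<in> acc lambda (S \<alpha>)"
    if ab: "\<alpha> < \<beta>" "\<beta> < mu0" for \<alpha> \<beta>
  proof -
    \<comment> \<open>Where \<open>f \<alpha> i < f \<beta> i\<close> fails, \<open>b i\<close> is
      arbitrary; this happens only on a null set of indices.\<close>
    have "\<exists>b. f \<alpha> i < f \<beta> i \<longrightarrow> b < lam i \<and>
        (\<forall>\<xi>\<in>C i (f \<beta> i). b < \<xi> \<longrightarrow> \<xi> \<in> acc (lam i) (C i (f \<alpha> i)))" for i
      using dp_sequence_almost_acc [OF assms(3) C _ f_less [OF ab(2)]] by blast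
    then obtain b where b: "\<And>i. f \<alpha> i < f \<beta> i \<Longrightarrow> b i < lam i"
      "\<And>i \<xi>. f \<alpha> i < f \<beta> i \<Longrightarrow> \<xi> \<in> C i (f \<beta> i) \<Longrightarrow> b i < \<xi> \<Longrightarrow> \<xi> \<in> acc (lam i) (C i (f \<alpha> i))"
      by metis
    have inc: "\<forall>\<^sub>F i in D. f \<alpha> i < f \<beta> i"
      using f_inc [OF ab] unfolding less_mod_def .
    then have "less_mod D b lam"
      unfolding less_mod_def by eventually_elim (rule b)
    then obtain \<gamma> where \<gamma>: "\<gamma> < lambda"
      "\<And>h \<sigma>. gh_norm D h = {..<\<sigma>} \<Longrightarrow> \<gamma> < \<sigma> \<Longrightarrow> less_mod D b h"
      using large_norm_dominates [OF assms(1,3,4) _ norm, of b] assms(5) by metis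
    have "\<sigma> \<in> acc lambda (S \<alpha>)" if s: "\<sigma> \<in> S \<beta>" "\<gamma> < \<sigma>" for \<sigma>
    proof -
      obtain h where h: "\<forall>\<^sub>F i in D. h i \<in> C i (f \<beta> i)" "gh_norm D h = {..<\<sigma>}"
        using s(1) unfolding S_def norm_values_def by blast
      have "\<forall>\<^sub>F i in D. b i < h i"
        using \<gamma>(2) [OF h(2) s(2)] unfolding less_mod_def .
      with inc h(1) have ev: "\<forall>\<^sub>F i in D. h i \<in> acc (lam i) (C i (f \<alpha> i))"
        by eventually_elim (rule b(2))
      have "\<sigma> < lambda" using s(1) S_sub [OF ab(2)] by blast
      then show ?thesis
        unfolding S_def by (rule norm_mem_acc_norm_values [OF norm _ ev h(2)])
    qed
    then show ?thesis using \<gamma>(1) by blast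
  qed
  \<comment> \<open>The closures of the sets \<open>S \<alpha>\<close> are clubs and inherit the
    almost inclusions, which trimming then makes exact at successors.\<close>
  then have "\<exists>\<gamma><lambda. \<forall>\<xi>\<in>S \<beta> \<union> acc lambda (S \<beta>). \<gamma> < \<xi> \<longrightarrow>
      \<xi> \<in> acc lambda (S \<alpha> \<union> acc lambda (S \<alpha>))" if "\<alpha> < \<beta>" "\<beta> < mu0" for \<alpha> \<beta>
    using closure_subset_acc that by metis
  moreover have "club lambda (S \<alpha> \<union> acc lambda (S \<alpha>))" if "\<alpha> < mu0" for \<alpha>
    using club_closure [OF S_sub [OF that]] norm_values_unbounded [OF norm clubC [OF that]]
    unfolding S_def by blast
  ultimately show ?thesis
    unfolding mem_dp1_plus_iff
    using dp_sequence_of_almost [of mu0 lambda "\<lambda>\<alpha>. S \<alpha> \<union> acc lambda (S \<alpha>)"] by blast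
qed

end
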